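(* Let $X$ be an infinite set. Then the maximal subsemigroups of $I_X$ which contain $\operatorname{Sym}(X)$ are exactly $$S_\mu = \{f \in I_X : c(f) \geq \mu \text{ or } d(f)<\mu\},$$ $$S_\mu^{-1} = \{f \in I_X : c(f)<\mu \text{ or } d(f) \geq \mu\},$$ where $\mu=1$ or $\mu$ is any infinite cardinal with $\mu \leq |X|$. The maximal inverse subsemigroups of $I_X$ which contain $\operatorname{Sym}(X)$ are exactly $$S_{\mu} \cap S_{\mu}^{-1} = \{f \in I_X : (c(f)\geq \mu \text{ and }d(f)\geq \mu) \text{ or } (c(f)<\mu \text{ and } d(f)<\mu)\}$$ over the same values of $\mu$.
   Context: $I_X$ denotes the symmetric inverse monoid on $X$: the set of all injective partial functions from $X$ to $X$ (bijections between subsets of $X$, including the empty one) under composition of partial functions, written on the right and composed from left to right. $\operatorname{Sym}(X)$ is the group of all permutations of $X$, a subset of $I_X$. For $f\in I_X$, the collapse is $c(f)=|X\setminus \operatorname{dom}(f)|$ and the defect is $d(f)=|X\setminus\operatorname{im}(f)|$. For $M\subseteq I_X$, $M^{-1}=\{f^{-1}:f\in M\}$. An inverse subsemigroup is a subsemigroup closed under $f\mapsto f^{-1}$. A maximal subsemigroup (respectively maximal inverse subsemigroup) is a maximal element, under containment, of the set of all proper subsemigroups (respectively proper inverse subsemigroups). *)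

theory Defs
  imports Main
begin

unbundle cardinal_syntax

text \<open>Partial functions are represented by their graphs. Composition from left to right is
  then relational composition \<open>(O)\<close>, the inverse is \<^const>\<open>converse\<close>, and domain and image are
  \<^const>\<open>Domain\<close> and \<^const>\<open>Range\<close>.\<close>

definition sym_inv_monoid :: "'a set \<Rightarrow> 'a rel set" where
  "sym_inv_monoid X = {f. f \<subseteq> X \<times> X \<and> single_valued f \<and> single_valued (f\<inverse>)}"

definition Sym :: "'a set \<Rightarrow> 'a rel set" where
  "Sym X = {f \<in> sym_inv_monoid X. Domain f = X \<and> Range f = X}"

definition collapse :: "'a set \<Rightarrow> 'a rel \<Rightarrow> 'a rel" where
  "collapse X f = |X - Domain f|"

definition defect :: "'a set \<Rightarrow> 'a rel \<Rightarrow> 'a rel" where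
  "defect X f = |X - Range f|"

text \<open>The empty set counts as a subsemigroup; this does not affect the maximal ones among those
  containing \<^term>\<open>Sym X\<close>.\<close>

definition subsemigroup :: "'a set \<Rightarrow> 'a rel set \<Rightarrow> bool" where
  "subsemigroup X M \<longleftrightarrow> M \<subseteq> sym_inv_monoid X \<and> (\<forall>f\<in>M. \<forall>g\<in>M. f O g \<in> M)"

definition inverse_subsemigroup :: "'a set \<Rightarrow> 'a rel set \<Rightarrow> bool" where
  "inverse_subsemigroup X M \<longleftrightarrow> subsemigroup X M \<and> (\<forall>f\<in>M. f\<inverse> \<in> M)"

definition maximal_in :: "'b set set \<Rightarrow> 'b set \<Rightarrow> bool" where
  "maximal_in \<A> M \<longleftrightarrow> M \<in> \<A> \<and> (\<forall>N\<in>\<A>. M \<subseteq> N \<longrightarrow> N = M)"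

definition maximal_subsemigroup :: "'a set \<Rightarrow> 'a rel set \<Rightarrow> bool" where
  "maximal_subsemigroup X =
     maximal_in {M. subsemigroup X M \<and> M \<noteq> sym_inv_monoid X}"

definition maximal_inverse_subsemigroup :: "'a set \<Rightarrow> 'a rel set \<Rightarrow> bool" where
  "maximal_inverse_subsemigroup X =
     maximal_in {M. inverse_subsemigroup X M \<and> M \<noteq> sym_inv_monoid X}"

text \<open>Cardinals are cardinal orders in the sense of \<^const>\<open>Card_order\<close>, compared by \<open>\<le>o\<close>, \<open><o\<close> and
  \<open>=o\<close>. As every cardinal at most \<open>|X|\<close> is represented by a cardinal order on the element type
  of \<open>X\<close>, letting \<open>\<mu>\<close> range over relations on that type loses nothing.\<close>

definition admissible :: "'a set \<Rightarrow> 'a rel \<Rightarrow> bool" where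
  "admissible X \<mu> \<longleftrightarrow> Card_order \<mu> \<and> (\<mu> =o cone \<or> cinfinite \<mu> \<and> \<mu> \<le>o |X| )"

definition S_mu :: "'a set \<Rightarrow> 'a rel \<Rightarrow> 'a rel set" where
  "S_mu X \<mu> = {f \<in> sym_inv_monoid X. \<mu> \<le>o collapse X f \<or> defect X f <o \<mu>}"

definition inv_set :: "'a rel set \<Rightarrow> 'a rel set" where
  "inv_set M = {f\<inverse> | f. f \<in> M}"

end

theory Submission
  imports Defs
begin

text \<open>
  Every proper subsemigroup \<open>M\<close> containing \<^term>\<open>Sym X\<close> lies inside one of the semigroups
  \<open>S\<^sub>\<mu>\<close>, \<open>S\<^sub>\<mu>\<inverse>\<close> (lemma \<open>proper_subsemigroup_below\<close>). Since these are themselves proper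
  subsemigroups containing \<^term>\<open>Sym X\<close>, and none contains another
  (\<open>S_mu_Int_inv_subset_S_mu\<close>, \<open>S_mu_not_subset_inv_S_mu\<close>), they are precisely the maximal ones.

  For the covering property, suppose that \<open>M\<close> lies in none of them. Avoiding \<open>S\<^sub>\<mu>\<close> provides, for
  each admissible \<open>\<mu>\<close>, an element of \<open>M\<close> whose collapse is below \<open>\<mu>\<close> and whose defect is at least
  \<open>\<mu>\<close>. The case \<open>\<mu> = 1\<close> is a total map that is not surjective, and its powers have arbitrarily large
  finite defect. From there induction over cardinals removes the collapse altogether: a total map
  already constructed has enough room outside its image to absorb, after a suitable permutation, the
  points at which the next element is undefined (\<open>total_large_defect\<close>). The result is a total
  \<open>u \<in> M\<close> of defect \<open>|X|\<close>. The same argument applied to \<open>M\<inverse>\<close> gives a surjective \<open>v \<in> M\<close> of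
  collapse \<open>|X|\<close>. Any two such elements already satisfy \<open>I\<^sub>X = u Sym(X) v\<close>
  (\<open>factor_through_Sym\<close>), so \<open>M\<close> is everything.

  The inverse case follows. A proper inverse subsemigroup containing \<^term>\<open>Sym X\<close> lies in some
  \<open>S\<^sub>\<mu>\<close> or \<open>S\<^sub>\<mu>\<inverse>\<close>, hence, being closed under inverses, in \<open>S\<^sub>\<mu> \<inter> S\<^sub>\<mu>\<inverse>\<close>; and the elements
  separating different \<open>S\<^sub>\<mu>\<close> can be chosen in these intersections.
\<close>

section \<open>Inverses in the symmetric inverse monoid\<close>

lemma sym_inv_monoidI:
  assumes "f \<subseteq> X \<times> X" "single_valued f" "single_valued (f\<inverse>)"
  shows "f \<in> sym_inv_monoid X"
  using assms by (simp add: sym_inv_monoid_def)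

lemma sym_inv_monoidD:
  assumes "f \<in> sym_inv_monoid X"
  shows "f \<subseteq> X \<times> X" "single_valued f" "single_valued (f\<inverse>)"
  using assms by (simp_all add: sym_inv_monoid_def)

lemma converse_in_sym_inv_monoid [simp]:
  "f\<inverse> \<in> sym_inv_monoid X \<longleftrightarrow> f \<in> sym_inv_monoid X"
  unfolding sym_inv_monoid_def by auto

lemma converse_in_Sym [simp]: "f\<inverse> \<in> Sym X \<longleftrightarrow> f \<in> Sym X"
  unfolding Sym_def by auto

lemma collapse_converse [simp]: "collapse X (f\<inverse>) = defect X f"
  and defect_converse [simp]: "defect X (f\<inverse>) = collapse X f"
  unfolding collapse_def defect_def by simp_all

lemma in_inv_set_iff [simp]: "f \<in> inv_set M \<longleftrightarrow> f\<inverse> \<in> M"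
  unfolding inv_set_def by (auto intro: exI[of _ "f\<inverse>"])

lemma inv_set_inv_set [simp]: "inv_set (inv_set M) = M"
  by auto

lemma inv_set_subset_iff: "inv_set M \<subseteq> N \<longleftrightarrow> M \<subseteq> inv_set N"
  unfolding subset_iff in_inv_set_iff by (metis converse_converse)

lemma inv_set_Sym [simp]: "inv_set (Sym X) = Sym X"
  by auto

lemma inv_set_sym_inv_monoid [simp]: "inv_set (sym_inv_monoid X) = sym_inv_monoid X"
  by auto

lemma comp_in_sym_inv_monoid:
  assumes "f \<in> sym_inv_monoid X" "g \<in> sym_inv_monoid X"
  shows "f O g \<in> sym_inv_monoid X"
proof (rule sym_inv_monoidI)
  note f = sym_inv_monoidD[OF assms(1)] and g = sym_inv_monoidD[OF assms(2)]
  show "f O g \<subseteq> X \<times> X"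
    using f(1) g(1) by blast
  show "single_valued (f O g)"
    using f(2) g(2) by (rule single_valued_relcomp)
  show "single_valued ((f O g)\<inverse>)"
    unfolding converse_relcomp using g(3) f(3) by (rule single_valued_relcomp)
qed

lemma Un_in_sym_inv_monoid:
  assumes "f \<in> sym_inv_monoid X" "g \<in> sym_inv_monoid X"
    and "Domain f \<inter> Domain g = {}" "Range f \<inter> Range g = {}"
  shows "f \<union> g \<in> sym_inv_monoid X"
proof (rule sym_inv_monoidI)
  note f = sym_inv_monoidD[OF assms(1)] and g = sym_inv_monoidD[OF assms(2)]
  show "f \<union> g \<subseteq> X \<times> X"
    using f(1) g(1) by (rule Un_least)
  show "single_valued (f \<union> g)"
    using f(2) g(2) assms(3) unfolding single_valued_def by blast
  show "single_valued ((f \<union> g)\<inverse>)"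
    using f(3) g(3) assms(4) unfolding single_valued_def by blast
qed

lemma subsemigroup_inv_set:
  assumes "subsemigroup X M"
  shows "subsemigroup X (inv_set M)"
  using assms unfolding subsemigroup_def by (auto simp: converse_relcomp)

section \<open>Cardinalities of subsets\<close>

lemma single_valued_Image_card_le:
  assumes "single_valued f"
  shows "|f `` B| \<le>o |B|"
proof -
  have "f `` B \<subseteq> (\<lambda>x. THE y. (x, y) \<in> f) ` B"
  proof
    fix y assume "y \<in> f `` B"
    then obtain x where x: "x \<in> B" "(x, y) \<in> f"
      by blast
    then have "(THE y. (x, y) \<in> f) = y"
      using assms by (auto intro: the_equality dest: single_valuedD)
    then show "y \<in> (\<lambda>x. THE y. (x, y) \<in> f) ` B"
      using x(1) by force
  qed
  then show ?thesis
    by (meson card_of_image card_of_mono1 ordLeq_transitive)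
qed

lemma not_card_le_iff:
  fixes A :: "'a set" and \<mu> :: "'a rel"
  assumes "Card_order \<mu>"
  shows "\<not> \<mu> \<le>o |A| \<longleftrightarrow> |A| <o \<mu>"
  using assms by (meson card_of_Well_order card_order_on_well_order_on not_ordLeq_iff_ordLess)

lemma obtain_matching:
  assumes "|A| =o |B|" "A \<subseteq> X" "B \<subseteq> X"
  obtains t where "t \<in> sym_inv_monoid X" "Domain t = A" "Range t = B"
proof -
  obtain p where p: "bij_betw p A B"
    using assms(1) card_of_ordIso by blast
  define t where "t = {(x, p x) | x. x \<in> A}"
  have "Domain t = A" "Range t = B"
    using p unfolding t_def bij_betw_def by auto
  moreover have "t \<in> sym_inv_monoid X"
    using p assms(2,3) unfolding t_def bij_betw_def
    by (auto intro!: sym_inv_monoidI single_valuedI dest: inj_onD)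
  ultimately show thesis using that by blast
qed

lemma obtain_subset_same_card:
  assumes "|A| \<le>o |X|"
  obtains B where "B \<subseteq> X" "|A| =o |B|"
  using that internalize_card_of_ordLeq2[of A X] assms by blast

lemma obtain_subset_of_card:
  assumes "Card_order \<kappa>" "\<kappa> \<le>o |X|"
  obtains A where "A \<subseteq> X" "|A| =o \<kappa>"
proof -
  have F: "|Field \<kappa>| =o \<kappa>"
    using assms(1) by (rule card_of_Field_ordIso)
  then have "|Field \<kappa>| \<le>o |X|"
    using assms(2) by (rule ordIso_ordLeq_trans)
  then obtain A where A: "A \<subseteq> X" "|Field \<kappa>| =o |A|"
    by (rule obtain_subset_same_card)
  show thesis
    using that[OF A(1)] ordIso_transitive[OF ordIso_symmetric[OF A(2)] F] .
qed

lemma split_infinite: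
  assumes "infinite X"
  obtains A B where "X = A \<union> B" "A \<inter> B = {}" "|A| =o |X|" "|B| =o |X|"
proof -
  have "|X <+> X| =o |X|"
    using assms card_of_mono1[OF order_refl] by (rule card_of_Plus_infinite1)
  then obtain p where p: "bij_betw p (X <+> X) X"
    using card_of_ordIso by blast
  have inj: "inj_on p (X <+> X)" and im: "p ` (X <+> X) = X"
    using p by (simp_all add: bij_betw_def)
  show thesis
  proof
    show "X = p ` Inl ` X \<union> p ` Inr ` X"
      using im by (auto simp: Plus_def image_Un)
    show "p ` Inl ` X \<inter> p ` Inr ` X = {}"
      using inj_on_image_Int[OF inj, of "Inl ` X" "Inr ` X"] by auto
    have "inj_on (p \<circ> Inl) X" "inj_on (p \<circ> Inr) X"
      by (auto intro!: comp_inj_on inj_on_subset[OF inj])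
    then have "bij_betw (p \<circ> Inl) X (p ` Inl ` X)" "bij_betw (p \<circ> Inr) X (p ` Inr ` X)"
      by (simp_all add: bij_betw_def image_comp)
    then show "|p ` Inl ` X| =o |X|" "|p ` Inr ` X| =o |X|"
      by (simp_all add: card_of_ordIsoI ordIso_symmetric)
  qed
qed

lemma card_eq_superset:
  assumes "A \<subseteq> B" "B \<subseteq> X" "|X| \<le>o |A|"
  shows "|B| =o |X|"
  using card_of_mono1[OF assms(2)] ordLeq_transitive[OF assms(3) card_of_mono1[OF assms(1)]]
  by (simp add: ordIso_iff_ordLeq)

section \<open>Elements with prescribed collapse and defect\<close>

text \<open>Splitting \<open>X\<close> into two halves of full size leaves room to remove subsets of the first half
  of any size from the domain and from the image: both remainders still contain the second half,
  hence can be matched.\<close>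

lemma exists_collapse_defect:
  assumes "infinite X" "Card_order \<kappa>" "\<kappa> \<le>o |X|" "Card_order \<nu>" "\<nu> \<le>o |X|"
  obtains f where "f \<in> sym_inv_monoid X" "collapse X f =o \<kappa>" "defect X f =o \<nu>"
proof -
  obtain H K where HK: "X = H \<union> K" "H \<inter> K = {}" "|H| =o |X|" "|K| =o |X|"
    using split_infinite[OF assms(1)] .
  have le: "\<kappa> \<le>o |H|" "\<nu> \<le>o |H|"
    using ordLeq_ordIso_trans[OF _ ordIso_symmetric[OF HK(3)]] assms(3,5) by blast+
  obtain A where A: "A \<subseteq> H" "|A| =o \<kappa>"
    using obtain_subset_of_card[OF assms(2) le(1)] .
  obtain B where B: "B \<subseteq> H" "|B| =o \<nu>"
    using obtain_subset_of_card[OF assms(4) le(2)] .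
  have "|X| \<le>o |K|"
    using HK(4) by (simp add: ordIso_iff_ordLeq)
  then have "|X - A| =o |X|" "|X - B| =o |X|"
    using A(1) B(1) HK(1,2) by (auto intro!: card_eq_superset[of K])
  then have "|X - A| =o |X - B|"
    by (rule ordIso_transitive[OF _ ordIso_symmetric])
  then obtain f where f: "f \<in> sym_inv_monoid X" "Domain f = X - A" "Range f = X - B"
    by (rule obtain_matching[where X = X]) auto
  have "X - (X - A) = A" "X - (X - B) = B"
    using A(1) B(1) HK(1) by auto
  then show thesis
    using that[OF f(1)] f(2,3) A(2) B(2) by (simp add: collapse_def defect_def)
qed

section \<open>The semigroups belonging to admissible cardinals\<close>

lemma admissible_Card_order: "admissible X \<mu> \<Longrightarrow> Card_order \<mu>"
  by (simp add: admissible_def)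

lemma admissible_pos:
  fixes \<mu> :: "'a rel"
  assumes "admissible X \<mu>"
  shows "|{} :: 'a set| <o \<mu>"
proof (rule ccontr)
  assume "\<not> |{} :: 'a set| <o \<mu>"
  then have le: "\<mu> \<le>o |{} :: 'a set|"
    by (simp add: not_card_le_iff[OF admissible_Card_order[OF assms], symmetric])
  have F: "|Field \<mu>| =o \<mu>"
    using assms by (simp add: admissible_def card_of_Field_ordIso)
  have "Field \<mu> = {}"
    using ordIso_ordLeq_trans[OF F le] by (rule card_of_empty3)
  moreover have "Field \<mu> \<noteq> {}"
  proof (cases "\<mu> =o cone")
    case True
    have "|{()}| =o |Field \<mu>|"
      using ordIso_symmetric[OF ordIso_transitive[OF F True]]
      by (simp add: cone_def)
    then have "|{()}| \<le>o |Field \<mu>|"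
      by (simp add: ordIso_iff_ordLeq)
    then show ?thesis
      using card_of_empty3[of "{()}"] by auto
  next
    case False
    then show ?thesis
      using assms unfolding admissible_def cinfinite_def by auto
  qed
  ultimately show False
    by contradiction
qed

lemma admissible_card_le:
  assumes "infinite X" "admissible X \<mu>"
  shows "\<mu> \<le>o |X|"
proof -
  have "cone \<le>o |X|"
    using assms(1) unfolding cone_def by (intro card_of_singl_ordLeq) auto
  then show ?thesis
    using assms(2) ordIso_ordLeq_trans[of \<mu> cone "|X|"] by (simp add: admissible_def) blast
qed

text \<open>Among nonzero cardinals up to \<open>|X|\<close>, the admissible ones are exactly those below which
  sums of two cardinals remain. This closure is what makes \<open>S_mu X \<mu>\<close> a semigroup, and
  it lets \<open>\<mu> = 1\<close> and infinite \<open>\<mu>\<close> be treated alike.\<close>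

lemma admissible_Un_less:
  fixes A B :: "'a set"
  assumes "admissible X \<mu>" "|A| <o \<mu>" "|B| <o \<mu>"
  shows "|A \<union> B| <o \<mu>"
proof (cases "\<mu> =o cone")
  case True
  have "D = {}" if "|D| <o \<mu>" for D :: "'a set"
  proof (rule ccontr)
    assume "D \<noteq> {}"
    then have "cone \<le>o |D|"
      unfolding cone_def by (rule card_of_singl_ordLeq)
    with True have "\<mu> \<le>o |D|"
      by (rule ordIso_ordLeq_trans)
    then show False
      using not_ordLess_ordLeq[OF that] by contradiction
  qed
  then have "A = {}" "B = {}"
    using assms(2,3) by blast+
  then show ?thesis
    using assms(2) by simp
next
  case False
  then have "infinite (Field \<mu>)" "Card_order \<mu>"
    using assms(1) by (auto simp: admissible_def cinfinite_def)
  then show ?thesis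
    using assms(2,3) by (rule card_of_Un_ordLess_infinite_Field)
qed

lemma Sym_subset_S_mu:
  assumes "admissible X \<mu>"
  shows "Sym X \<subseteq> S_mu X \<mu>"
  using admissible_pos[OF assms] unfolding Sym_def S_mu_def defect_def by auto

lemma inv_S_mu_eq:
  "inv_set (S_mu X \<mu>) = {f \<in> sym_inv_monoid X. collapse X f <o \<mu> \<or> \<mu> \<le>o defect X f}"
  unfolding S_mu_def by (intro set_eqI) (simp add: disj_commute)

lemma not_in_S_mu_iff:
  assumes "Card_order \<mu>" "f \<in> sym_inv_monoid X"
  shows "f \<notin> S_mu X \<mu> \<longleftrightarrow> collapse X f <o \<mu> \<and> \<mu> \<le>o defect X f"
  using assms(2) not_card_le_iff[OF assms(1), of "X - Domain f"]
    not_card_le_iff[OF assms(1), of "X - Range f"]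
  unfolding S_mu_def collapse_def defect_def by blast

lemma S_mu_Int_inv_eq:
  assumes "Card_order \<mu>"
  shows "S_mu X \<mu> \<inter> inv_set (S_mu X \<mu>) =
    {f \<in> sym_inv_monoid X. (\<mu> \<le>o collapse X f \<and> \<mu> \<le>o defect X f)
       \<or> (collapse X f <o \<mu> \<and> defect X f <o \<mu>)}"
  unfolding inv_S_mu_eq
  using not_card_le_iff[OF assms] unfolding S_mu_def collapse_def defect_def by blast

text \<open>A large collapse of \<open>f\<close> is inherited by \<open>f O g\<close>. If \<open>f\<close> has small collapse instead, then it
  also has small defect, being in \<open>S_mu X \<mu>\<close>. A large
  collapse of \<open>g\<close> then survives in \<open>f O g\<close>, because the few points missed by \<open>f\<close> cannot account for
  all points at which \<open>g\<close> is undefined; and a small defect of \<open>g\<close> grows only by the small defect of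
  \<open>f\<close>.\<close>

lemma S_mu_subsemigroup:
  assumes "admissible X \<mu>"
  shows "subsemigroup X (S_mu X \<mu>)"
proof -
  have C: "Card_order \<mu>"
    using assms by (rule admissible_Card_order)
  have "f O g \<in> S_mu X \<mu>" if f: "f \<in> S_mu X \<mu>" and g: "g \<in> S_mu X \<mu>" for f g
  proof (rule ccontr)
    have I: "f \<in> sym_inv_monoid X" "g \<in> sym_inv_monoid X"
      using f g by (simp_all add: S_mu_def)
    assume "f O g \<notin> S_mu X \<mu>"
    then have small: "|X - Domain (f O g)| <o \<mu>" and large: "\<mu> \<le>o |X - Range (f O g)|"
      using not_in_S_mu_iff[OF C comp_in_sym_inv_monoid[OF I]]
      by (simp_all add: collapse_def defect_def)
    have "|X - Domain f| \<le>o |X - Domain (f O g)|"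
      by (rule card_of_mono1) auto
    then have "|X - Domain f| <o \<mu>"
      using small by (rule ordLeq_ordLess_trans)
    then have df: "|X - Range f| <o \<mu>"
      using f not_card_le_iff[OF C] unfolding S_mu_def collapse_def defect_def by blast
    have "X - Domain g \<subseteq> (X - Range f) \<union> f `` (X - Domain (f O g))"
      using sym_inv_monoidD[OF I(1)] unfolding single_valued_def by blast
    moreover have "|f `` (X - Domain (f O g))| <o \<mu>"
      using single_valued_Image_card_le[OF sym_inv_monoidD(2)[OF I(1)]] small
      by (rule ordLeq_ordLess_trans)
    ultimately have "|X - Domain g| <o \<mu>"
      by (meson admissible_Un_less[OF assms df] card_of_mono1 ordLeq_ordLess_trans)
    then have dg: "|X - Range g| <o \<mu>"
      using g not_card_le_iff[OF C] unfolding S_mu_def collapse_def defect_def by blast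
    have "X - Range (f O g) \<subseteq> (X - Range g) \<union> g `` (X - Range f)"
      using sym_inv_monoidD[OF I(2)] by blast
    moreover have "|g `` (X - Range f)| <o \<mu>"
      using single_valued_Image_card_le[OF sym_inv_monoidD(2)[OF I(2)]] df
      by (rule ordLeq_ordLess_trans)
    ultimately have "|X - Range (f O g)| <o \<mu>"
      by (meson admissible_Un_less[OF assms dg] card_of_mono1 ordLeq_ordLess_trans)
    then show False
      using large not_ordLess_ordLeq by blast
  qed
  then show ?thesis
    unfolding subsemigroup_def S_mu_def by blast
qed

section \<open>The family of these semigroups is an antichain\<close>

lemma S_mu_cong:
  assumes "\<mu> =o \<nu>"
  shows "S_mu X \<mu> = S_mu X \<nu>"
proof -
  have "\<mu> \<le>o r \<longleftrightarrow> \<nu> \<le>o r" "r <o \<mu> \<longleftrightarrow> r <o \<nu>" for r :: "'a rel"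
    using ordIso_ordLeq_trans[OF assms, of r] ordLess_ordIso_trans[OF _ assms, of r]
      ordIso_ordLeq_trans[OF ordIso_symmetric[OF assms], of r]
      ordLess_ordIso_trans[OF _ ordIso_symmetric[OF assms], of r]
    by blast+
  then show ?thesis
    unfolding S_mu_def by simp
qed

text \<open>Two witnesses separate different cardinals: an element with collapse \<open>0\<close> and defect \<open>\<nu>\<close> when
  \<open>\<nu> < \<mu>\<close>, and one with collapse \<open>\<mu>\<close> and defect \<open>\<nu>\<close> when \<open>\<mu> < \<nu>\<close>. Both even lie in the intersection
  with the inverse semigroup, so the same separation serves semigroups and inverse semigroups.\<close>

lemma S_mu_Int_inv_subset_S_mu:
  assumes "infinite X" "admissible X \<mu>" "admissible X \<nu>"
    and sub: "S_mu X \<mu> \<inter> inv_set (S_mu X \<mu>) \<subseteq> S_mu X \<nu>"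
  shows "S_mu X \<mu> = S_mu X \<nu>"
proof -
  note C = admissible_Card_order[OF assms(2)] admissible_Card_order[OF assms(3)]
  note le = admissible_card_le[OF assms(1,2)] admissible_card_le[OF assms(1,3)]
  have zero: "Card_order |{} :: 'a set|" "|{} :: 'a set| \<le>o |X|"
    using card_of_Card_order card_of_empty by blast+
  note pos = admissible_pos[OF assms(2)] admissible_pos[OF assms(3)]
  have "\<not> \<nu> <o \<mu>"
  proof
    assume lt: "\<nu> <o \<mu>"
    obtain f where f: "f \<in> sym_inv_monoid X" "collapse X f =o |{} :: 'a set|" "defect X f =o \<nu>"
      using exists_collapse_defect[OF assms(1) zero C(2) le(2)] .
    have "collapse X f <o \<mu>" "defect X f <o \<mu>"
      using ordIso_ordLess_trans[OF f(2) pos(1)] ordIso_ordLess_trans[OF f(3) lt] .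
    then have "f \<in> S_mu X \<nu>"
      using sub f(1) unfolding S_mu_Int_inv_eq[OF C(1)] by blast
    moreover have "collapse X f <o \<nu>" "\<nu> \<le>o defect X f"
      using ordIso_ordLess_trans[OF f(2) pos(2)] f(3) by (simp_all add: ordIso_iff_ordLeq)
    ultimately show False
      using not_in_S_mu_iff[OF C(2) f(1)] by blast
  qed
  moreover have "\<not> \<mu> <o \<nu>"
  proof
    assume lt: "\<mu> <o \<nu>"
    obtain f where f: "f \<in> sym_inv_monoid X" "collapse X f =o \<mu>" "defect X f =o \<nu>"
      using exists_collapse_defect[OF assms(1) C(1) le(1) C(2) le(2)] .
    have "\<mu> \<le>o collapse X f" "\<nu> \<le>o defect X f"
      using f(2,3) by (simp_all add: ordIso_iff_ordLeq)
    moreover have "\<mu> \<le>o defect X f"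
      using ordLess_imp_ordLeq[OF lt] \<open>\<nu> \<le>o defect X f\<close> by (rule ordLeq_transitive)
    ultimately have "f \<in> S_mu X \<nu>"
      using sub f(1) unfolding S_mu_Int_inv_eq[OF C(1)] by blast
    moreover have "collapse X f <o \<nu>"
      using f(2) lt by (rule ordIso_ordLess_trans)
    ultimately show False
      using not_in_S_mu_iff[OF C(2) f(1)] \<open>\<nu> \<le>o defect X f\<close> by blast
  qed
  ultimately have "\<mu> =o \<nu>"
    using C by (meson card_order_on_well_order_on not_ordLess_iff_ordLeq ordIso_iff_ordLeq)
  then show ?thesis
    by (rule S_mu_cong)
qed

text \<open>An element with collapse \<open>|X|\<close> and defect \<open>0\<close> satisfies both alternatives defining
  \<open>S_mu X \<mu>\<close>, whatever \<open>\<mu>\<close> is, and neither alternative for the inverse semigroup.\<close>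

lemma S_mu_not_subset_inv_S_mu:
  assumes "infinite X" "admissible X \<mu>" "admissible X \<nu>"
  shows "\<not> S_mu X \<mu> \<subseteq> inv_set (S_mu X \<nu>)"
proof
  assume sub: "S_mu X \<mu> \<subseteq> inv_set (S_mu X \<nu>)"
  have zero: "Card_order |{} :: 'a set|" "|{} :: 'a set| \<le>o |X|"
    using card_of_Card_order card_of_empty by blast+
  have full: "Card_order |X|" "|X| \<le>o |X|"
    using card_of_Card_order card_of_mono1 by blast+
  obtain f where f: "f \<in> sym_inv_monoid X" "collapse X f =o |X|" "defect X f =o |{} :: 'a set|"
    using exists_collapse_defect[OF assms(1) full zero] .
  have large: "\<kappa> \<le>o collapse X f" and small: "defect X f <o \<kappa>" if "admissible X \<kappa>" for \<kappa>
  proof -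
    show "\<kappa> \<le>o collapse X f"
      using admissible_card_le[OF assms(1) that] ordIso_symmetric[OF f(2)]
      by (rule ordLeq_ordIso_trans)
    show "defect X f <o \<kappa>"
      using f(3) admissible_pos[OF that] by (rule ordIso_ordLess_trans)
  qed
  have "f \<in> S_mu X \<mu>"
    using f(1) large[OF assms(2)] by (simp add: S_mu_def)
  moreover have "f\<inverse> \<notin> S_mu X \<nu>"
    using not_in_S_mu_iff[OF admissible_Card_order[OF assms(3)], of "f\<inverse>" X] f(1)
      large[OF assms(3)] small[OF assms(3)] by simp
  ultimately show False
    using sub by auto
qed

section \<open>Subsemigroups outside every member of the family\<close>

text \<open>If at least as many points are missed by a total \<open>h\<close> as are absent from the domain of \<open>f\<close>,
  the latter can be placed inside the former, and then \<open>f\<close> is applied to the image of \<open>h\<close>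
  without loss. The placement extends to a permutation because the rest of \<open>X\<close> on either side has
  size \<open>|X|\<close>: on one side it is \<open>Domain f\<close>, whose complement is smaller than \<open>X\<close>, and on the other
  it contains the image of the total \<open>h\<close>.\<close>

lemma total_composite:
  assumes "infinite X" "h \<in> sym_inv_monoid X" "f \<in> sym_inv_monoid X"
    and total: "Domain h = X"
    and room: "|X - Domain f| \<le>o |X - Range h|"
    and few: "|X - Domain f| <o |X|"
  obtains s where "s \<in> Sym X" "Domain (h O s O f) = X"
proof -
  note h = sym_inv_monoidD[OF assms(2)] and f = sym_inv_monoidD[OF assms(3)]
  obtain D where D: "D \<subseteq> X - Range h" "|X - Domain f| =o |D|"
    using room by (rule obtain_subset_same_card)
  have "|Domain f| =o |X|"
  proof (rule card_eq_superset[OF subset_refl])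
    show "Domain f \<subseteq> X"
      using f(1) by auto
    then have "Domain f \<union> (X - Domain f) = X"
      by blast
    then have "\<not> |Domain f| <o |X|"
      using card_of_Un_ordLess_infinite[OF assms(1) _ few, of "Domain f"] ordLess_irreflexive by auto
    then show "|X| \<le>o |Domain f|"
      using not_card_le_iff[OF card_of_Card_order] by blast
  qed
  moreover have "|X - D| =o |X|"
  proof (rule card_eq_superset[of "Range h"])
    have "X \<subseteq> (h\<inverse>) `` Range h"
      using total by blast
    then show "|X| \<le>o |Range h|"
      by (rule ordLeq_transitive[OF card_of_mono1 single_valued_Image_card_le[OF h(3)]])
  qed (use D h(1) in auto)
  ultimately have "|X - D| =o |Domain f|"
    by (rule ordIso_transitive[OF _ ordIso_symmetric, rotated])
  then obtain s where s: "s \<in> sym_inv_monoid X" "Domain s = X - D" "Range s = Domain f"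
    by (rule obtain_matching[where X = X]) (use f in auto)
  have "|D| =o |X - Domain f|"
    using D(2) by (rule ordIso_symmetric)
  then obtain t where t: "t \<in> sym_inv_monoid X" "Domain t = D" "Range t = X - Domain f"
    by (rule obtain_matching[where X = X]) (use D in auto)
  have "s \<union> t \<in> sym_inv_monoid X"
    using s t by (intro Un_in_sym_inv_monoid) auto
  moreover have "Domain (s \<union> t) = X" "Range (s \<union> t) = X"
    unfolding Domain_Un_eq Range_Un_eq s(2,3) t(2,3) using D(1) f(1) by blast+
  moreover have "Domain (h O (s \<union> t) O f) = X"
  proof
    show "X \<subseteq> Domain (h O (s \<union> t) O f)"
    proof
      fix x assume "x \<in> X"
      then obtain y where y: "(x, y) \<in> h" "y \<in> X - D"
        using total D(1) h(1) by blast
      then obtain z where "(y, z) \<in> s" "z \<in> Domain f"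
        using s(2,3) by blast
      then show "x \<in> Domain (h O (s \<union> t) O f)"
        using y by blast
    qed
  qed (use h in auto)
  ultimately show thesis
    using that unfolding Sym_def by blast
qed

text \<open>Composing a total \<open>h\<close> with a total non-surjective \<open>f\<close> produces at least one more missed
  point than \<open>h\<close> has: the images under \<open>f\<close> of the points missed by \<open>h\<close>, and a point missed by \<open>f\<close> itself.\<close>

lemma total_large_finite_defect:
  assumes M: "subsemigroup X M" and Sym: "Sym X \<subseteq> M"
    and f: "f \<in> M" "Domain f = X" "y \<in> X - Range f"
    and "finite A"
  shows "\<exists>h\<in>M. Domain h = X \<and> |A| \<le>o |X - Range h|"
  using \<open>finite A\<close>
proof induction
  case empty
  have "Id_on X \<in> Sym X"
    unfolding Sym_def by (auto intro!: sym_inv_monoidI single_valuedI)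
  then have "Id_on X \<in> M"
    using Sym by blast
  then show ?case
    using card_of_empty by (intro bexI[of _ "Id_on X"]) auto
next
  case (insert a A)
  then obtain h where h: "h \<in> M" "Domain h = X" "|A| \<le>o |X - Range h|"
    by blast
  have "f \<in> sym_inv_monoid X" "h \<in> sym_inv_monoid X"
    using M f(1) h(1) unfolding subsemigroup_def by blast+
  note F = sym_inv_monoidD[OF this(1)] and H = sym_inv_monoidD[OF this(2)]
  have "X - Range h \<subseteq> (f\<inverse>) `` (f `` (X - Range h))"
    using f(2) by blast
  then have "|X - Range h| \<le>o |f `` (X - Range h)|"
    by (rule ordLeq_transitive[OF card_of_mono1 single_valued_Image_card_le[OF F(3)]])
  with h(3) have "|A| \<le>o |f `` (X - Range h)|"
    by (rule ordLeq_transitive)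
  then obtain g where g: "inj_on g A" "g ` A \<subseteq> f `` (X - Range h)"
    unfolding card_of_ordLeq[symmetric] by blast
  have "f `` (X - Range h) \<subseteq> X - Range (h O f)"
    using F unfolding single_valued_def by blast
  with g(2) have "g ` A \<subseteq> X - Range (h O f)"
    by (rule subset_trans)
  moreover have "y \<in> X - Range (h O f)"
    using f(3) by blast
  moreover have "(g(a := y)) ` insert a A = insert y (g ` A)"
    using insert(2) by auto
  ultimately have "(g(a := y)) ` insert a A \<subseteq> X - Range (h O f)"
    by simp
  moreover have "inj_on (g(a := y)) (insert a A)"
  proof -
    have "y \<notin> g ` A"
      using g(2) f(3) by blast
    then show ?thesis
      using g(1) insert(2) by (auto simp: inj_on_def)
  qed
  ultimately have "|insert a A| \<le>o |X - Range (h O f)|"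
    using card_of_ordLeq by blast
  moreover have "Domain (h O f) = X"
    using h(2) f(2) H(1) by blast
  moreover have "h O f \<in> M"
    using M h(1) f(1) unfolding subsemigroup_def by blast
  ultimately show ?case
    by blast
qed

lemma admissible_singleton: "admissible X |{x}|"
  unfolding admissible_def cone_def
  by (simp add: card_of_Card_order card_of_singl_ordLeq ordIso_iff_ordLeq)

lemma admissible_infinite_subset:
  assumes "A \<subseteq> X" "infinite A"
  shows "admissible X |A|"
  using assms(2) card_of_Card_order[of A] card_of_mono1[OF assms(1)]
  unfolding admissible_def cinfinite_def by (simp add: Field_card_of)

text \<open>For infinite \<open>A\<close>, some \<open>f \<in> M\<close> outside \<open>S_mu X |A|\<close> has collapse below \<open>|A|\<close> and defect at
  least \<open>|A|\<close>. By induction on the cardinal, some total \<open>h \<in> M\<close> misses at least as many points as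
  the collapse of \<open>f\<close>. By \<open>total_composite\<close>, a product of \<open>h\<close>, a permutation and \<open>f\<close> is then
  total, and it misses all points that \<open>f\<close> misses. For finite \<open>A\<close> an element outside
  \<open>S_mu X 1\<close> suffices: it is total and not surjective.\<close>

lemma total_large_defect:
  fixes A :: "'a set"
  assumes "infinite X" and M: "subsemigroup X M" and Sym: "Sym X \<subseteq> M"
    and out: "\<And>\<mu>. admissible X \<mu> \<Longrightarrow> \<not> M \<subseteq> S_mu X \<mu>"
  shows "A \<subseteq> X \<Longrightarrow> \<exists>h\<in>M. Domain h = X \<and> |A| \<le>o |X - Range h|"
proof (induction A rule: wf_induct_rule[OF wf_inv_image[OF wf_ordLess, of card_of]])
  case (1 A)
  have MI: "M \<subseteq> sym_inv_monoid X"
    using M by (simp add: subsemigroup_def)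
  have witness: "\<exists>f\<in>M. |X - Domain f| <o \<mu> \<and> \<mu> \<le>o |X - Range f|" if "admissible X \<mu>" for \<mu>
    using out[OF that] not_in_S_mu_iff[OF admissible_Card_order[OF that]] MI
    unfolding collapse_def defect_def by blast
  show ?case
  proof (cases "finite A")
    case True
    \<comment> \<open>Any singleton represents the cardinal \<open>1\<close>.\<close>
    obtain f where f: "f \<in> M" "|X - Domain f| <o |{undefined :: 'a}|"
      "|{undefined :: 'a}| \<le>o |X - Range f|"
      using witness[OF admissible_singleton] by blast
    have "X - Domain f = {}"
      using not_ordLess_ordLeq[OF f(2)]
        card_of_singl_ordLeq[of "X - Domain f" "undefined :: 'a"] by blast
    then have "Domain f = X"
      using f(1) MI sym_inv_monoidD(1) by blast
    moreover have "X - Range f \<noteq> {}"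
      using f(3) card_of_empty3[of "{undefined :: 'a}"] by (metis insert_not_empty)
    then obtain y where "y \<in> X - Range f"
      by blast
    ultimately show ?thesis
      using total_large_finite_defect[OF M Sym f(1)] True by blast
  next
    case False
    obtain f where f: "f \<in> M" "|X - Domain f| <o |A|" "|A| \<le>o |X - Range f|"
      using witness[OF admissible_infinite_subset[OF 1(2) False]] by blast
    then obtain h where h: "h \<in> M" "Domain h = X" "|X - Domain f| \<le>o |X - Range h|"
      using 1(1)[of "X - Domain f"] by auto
    have I: "h \<in> sym_inv_monoid X" "f \<in> sym_inv_monoid X"
      using MI f(1) h(1) by blast+
    have "|X - Domain f| <o |X|"
      using f(2) card_of_mono1[OF 1(2)] by (rule ordLess_ordLeq_trans)
    then obtain s where s: "s \<in> Sym X" "Domain (h O s O f) = X"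
      using total_composite[OF assms(1) I h(2,3)] by blast
    have "|X - Range f| \<le>o |X - Range (h O s O f)|"
      by (rule card_of_mono1) auto
    with f(3) have "|A| \<le>o |X - Range (h O s O f)|"
      by (rule ordLeq_transitive)
    moreover have "h O s O f \<in> M"
      using M Sym s(1) f(1) h(1) unfolding subsemigroup_def by blast
    ultimately show ?thesis
      using s(2) by blast
  qed
qed

text \<open>A total \<open>u\<close> and a surjective \<open>v\<close> reach every \<open>f\<close> once the defect of \<open>u\<close> and the collapse
  of \<open>v\<close> are \<open>|X|\<close>. On the copy
  \<open>u\<inverse> O f O v\<inverse>\<close> of \<open>f\<close> the permutation is forced. The copy of \<open>X - Domain f\<close> inside
  \<open>Range u\<close> must be sent outside \<open>Domain v\<close>; one half \<open>H\<close> of that space receives it, while the other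
  half \<open>K\<close> guarantees that what remains to be hit has size \<open>|X|\<close> and can be matched with
  \<open>X - Range u\<close>.\<close>

lemma factor_through_Sym:
  assumes "infinite X" "f \<in> sym_inv_monoid X"
    and u: "u \<in> sym_inv_monoid X" "Domain u = X" "|X| \<le>o |X - Range u|"
    and v: "v \<in> sym_inv_monoid X" "Range v = X" "|X| \<le>o |X - Domain v|"
  obtains s where "s \<in> Sym X" "u O s O v = f"
proof -
  note U = sym_inv_monoidD[OF u(1)] and V = sym_inv_monoidD[OF v(1)]
    and F = sym_inv_monoidD[OF assms(2)]
  define s0 where "s0 = u\<inverse> O f O v\<inverse>"
  have s0: "s0 \<in> sym_inv_monoid X"
    unfolding s0_def using assms(2) u(1) v(1) by (intro comp_in_sym_inv_monoid) simp_all
  have us0v: "u O s0 O v = f"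
  proof
    show "u O s0 O v \<subseteq> f"
      using U V unfolding s0_def single_valued_def by blast
    show "f \<subseteq> u O s0 O v"
      using F(1) u(2) v(2) unfolding s0_def by blast
  qed
  have dom0: "Domain s0 \<subseteq> Range u" and ran0: "Range s0 \<subseteq> Domain v"
    unfolding s0_def by auto
  have "infinite (X - Domain v)"
    using v(3) assms(1) by (rule card_of_ordLeq_infinite)
  then obtain H K where HK: "X - Domain v = H \<union> K" "H \<inter> K = {}"
    "|H| =o |X - Domain v|" "|K| =o |X - Domain v|"
    by (rule split_infinite)
  have "|X| \<le>o |H|" "|X| \<le>o |K|"
    using ordLeq_ordIso_trans[OF v(3) ordIso_symmetric] HK(3,4) by blast+
  moreover have "Range u - Domain s0 \<subseteq> X"
    using U(1) by auto
  ultimately have "|Range u - Domain s0| \<le>o |H|"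
    by (metis card_of_mono1 ordLeq_transitive)
  then obtain H' where H': "H' \<subseteq> H" "|Range u - Domain s0| =o |H'|"
    by (rule obtain_subset_same_card)
  obtain t1 where t1: "t1 \<in> sym_inv_monoid X" "Domain t1 = Range u - Domain s0" "Range t1 = H'"
    using H'(2) by (rule obtain_matching[where X = X]) (use H' HK U in auto)
  define Q where "Q = X - Range s0 - H'"
  have "K \<subseteq> Q"
    using HK H' ran0 unfolding Q_def by blast
  then have "|Q| =o |X|"
    by (rule card_eq_superset[OF _ _ \<open>|X| \<le>o |K|\<close>]) (auto simp: Q_def)
  moreover have "|X - Range u| =o |X|"
    using u(3) by (intro card_eq_superset[of "X - Range u"]) auto
  ultimately have "|X - Range u| =o |Q|"
    by (rule ordIso_transitive[OF _ ordIso_symmetric, rotated])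
  then obtain t2 where t2: "t2 \<in> sym_inv_monoid X" "Domain t2 = X - Range u" "Range t2 = Q"
    by (rule obtain_matching[where X = X]) (auto simp: Q_def)
  have H'v: "H' \<inter> Domain v = {}" "H' \<subseteq> X"
    using HK H' by auto
  define s where "s = s0 \<union> (t1 \<union> t2)"
  have "t1 \<union> t2 \<in> sym_inv_monoid X"
    using t1 t2 by (intro Un_in_sym_inv_monoid) (auto simp: Q_def)
  moreover have "Domain s0 \<inter> Domain (t1 \<union> t2) = {}"
    unfolding Domain_Un_eq t1(2) t2(2) using dom0 by blast
  moreover have "Range s0 \<inter> Range (t1 \<union> t2) = {}"
    unfolding Range_Un_eq t1(3) t2(3) Q_def using ran0 H'v(1) by blast
  ultimately have "s \<in> sym_inv_monoid X"
    unfolding s_def by (rule Un_in_sym_inv_monoid[OF s0])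
  moreover have "Domain s = X"
    unfolding s_def Domain_Un_eq t1(2) t2(2) using dom0 U(1) by blast
  moreover have "Range s = X"
    unfolding s_def Range_Un_eq t1(3) t2(3) Q_def using sym_inv_monoidD(1)[OF s0] H'v by blast
  moreover have "u O s O v = f"
  proof -
    have "u O t1 O v = {}"
      using t1(3) H'v(1) by blast
    moreover have "u O t2 O v = {}"
      using t2(2) by blast
    moreover have "u O s O v = u O s0 O v \<union> (u O t1 O v \<union> u O t2 O v)"
      unfolding s_def by blast
    ultimately show ?thesis
      using us0v by simp
  qed
  ultimately show thesis
    using that unfolding Sym_def by blast
qed

lemma proper_subsemigroup_below:
  assumes "infinite X" and M: "subsemigroup X M" and Sym: "Sym X \<subseteq> M"
    and proper: "M \<noteq> sym_inv_monoid X"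
  shows "\<exists>\<mu>. admissible X \<mu> \<and> (M \<subseteq> S_mu X \<mu> \<or> M \<subseteq> inv_set (S_mu X \<mu>))"
proof (rule ccontr)
  assume *: "\<not> ?thesis"
  have MI: "M \<subseteq> sym_inv_monoid X"
    using M by (simp add: subsemigroup_def)
  obtain u where u: "u \<in> M" "Domain u = X" "|X| \<le>o |X - Range u|"
    using total_large_defect[OF assms(1) M Sym, of X] * by blast
  have "Sym X \<subseteq> inv_set M"
    using Sym inv_set_subset_iff[of "Sym X" M] by simp
  moreover have "\<not> inv_set M \<subseteq> S_mu X \<mu>" if "admissible X \<mu>" for \<mu>
    using * that by (auto simp: inv_set_subset_iff)
  ultimately obtain w where w: "w \<in> inv_set M" "Domain w = X" "|X| \<le>o |X - Range w|"
    using total_large_defect[OF assms(1) subsemigroup_inv_set[OF M], of X] by blast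
  have "f \<in> M" if f: "f \<in> sym_inv_monoid X" for f
  proof -
    have "w\<inverse> \<in> M"
      using w(1) by simp
    then have I: "u \<in> sym_inv_monoid X" "w\<inverse> \<in> sym_inv_monoid X"
      using MI u(1) by blast+
    obtain s where "s \<in> Sym X" "u O s O w\<inverse> = f"
      by (rule factor_through_Sym[OF assms(1) f I(1) u(2,3) I(2)]) (use w in simp_all)
    then show ?thesis
      using M Sym u(1) \<open>w\<inverse> \<in> M\<close> unfolding subsemigroup_def by blast
  qed
  then show False
    using proper MI by blast
qed

section \<open>Maximal elements\<close>

lemma S_mu_proper:
  assumes "infinite X" "admissible X \<mu>"
  shows "S_mu X \<mu> \<noteq> sym_inv_monoid X"
proof
  assume "S_mu X \<mu> = sym_inv_monoid X"
  then have "S_mu X \<mu> \<subseteq> inv_set (S_mu X \<mu>)"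
    by simp
  then show False
    using S_mu_not_subset_inv_S_mu[OF assms assms(2)] by blast
qed

text \<open>An antichain \<open>\<F>\<close> that covers the members of \<open>\<A>\<close> containing \<open>S\<close> covers the members of \<open>\<A>\<close>
  above them too. Hence it suffices to look at members containing \<open>S\<close>, although maximality refers to
  all of \<open>\<A>\<close>.\<close>

lemma maximal_in_eq_antichain:
  assumes "\<F> \<subseteq> \<A>"
    and "\<And>F. F \<in> \<F> \<Longrightarrow> S \<subseteq> F"
    and "\<And>F G. F \<in> \<F> \<Longrightarrow> G \<in> \<F> \<Longrightarrow> F \<subseteq> G \<Longrightarrow> F = G"
    and "\<And>N. N \<in> \<A> \<Longrightarrow> S \<subseteq> N \<Longrightarrow> \<exists>F\<in>\<F>. N \<subseteq> F"
  shows "{M. maximal_in \<A> M \<and> S \<subseteq> M} = \<F>"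
proof (intro equalityI subsetI)
  fix M assume "M \<in> {M. maximal_in \<A> M \<and> S \<subseteq> M}"
  then have M: "M \<in> \<A>" "S \<subseteq> M" and max: "\<And>N. N \<in> \<A> \<Longrightarrow> M \<subseteq> N \<Longrightarrow> N = M"
    unfolding maximal_in_def by auto
  obtain F where "F \<in> \<F>" "M \<subseteq> F"
    using assms(4)[OF M] by blast
  then show "M \<in> \<F>"
    using max assms(1) by blast
next
  fix F assume F: "F \<in> \<F>"
  have "N = F" if N: "N \<in> \<A>" "F \<subseteq> N" for N
  proof -
    obtain G where G: "G \<in> \<F>" "N \<subseteq> G"
      using assms(4)[OF N(1)] assms(2)[OF F] N(2) by blast
    then have "F = G"
      using assms(3)[OF F] N(2) by blast
    then show ?thesis
      using G(2) N(2) by blast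
  qed
  then show "F \<in> {M. maximal_in \<A> M \<and> S \<subseteq> M}"
    using F assms(1,2) unfolding maximal_in_def by blast
qed

lemma maximal_subsemigroups_containing_Sym:
  assumes "infinite X"
  shows "{M. maximal_subsemigroup X M \<and> Sym X \<subseteq> M} =
    {S_mu X \<mu> | \<mu>. admissible X \<mu>} \<union> {inv_set (S_mu X \<mu>) | \<mu>. admissible X \<mu>}"
  unfolding maximal_subsemigroup_def
proof (rule maximal_in_eq_antichain)
  let ?F = "{S_mu X \<mu> | \<mu>. admissible X \<mu>} \<union> {inv_set (S_mu X \<mu>) | \<mu>. admissible X \<mu>}"
  have "inv_set (S_mu X \<mu>) \<noteq> sym_inv_monoid X" if "admissible X \<mu>" for \<mu>
    using S_mu_proper[OF assms that] inv_set_inv_set inv_set_sym_inv_monoid by metis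
  then show "?F \<subseteq> {M. subsemigroup X M \<and> M \<noteq> sym_inv_monoid X}"
    using S_mu_proper[OF assms] S_mu_subsemigroup subsemigroup_inv_set by blast
  show "Sym X \<subseteq> F" if "F \<in> ?F" for F
    using that Sym_subset_S_mu by (auto simp: subset_iff)
  have inv_mono: "M \<subseteq> N" if "inv_set M \<subseteq> inv_set N" for M N :: "'a rel set"
    using that by (simp add: inv_set_subset_iff)
  have eq: "S_mu X \<mu> = S_mu X \<nu>"
    if "admissible X \<mu>" "admissible X \<nu>" "S_mu X \<mu> \<subseteq> S_mu X \<nu>" for \<mu> \<nu>
    using that by (intro S_mu_Int_inv_subset_S_mu[OF assms]) auto
  have "\<not> inv_set (S_mu X \<mu>) \<subseteq> S_mu X \<nu>" if "admissible X \<mu>" "admissible X \<nu>" for \<mu> \<nu>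
    using S_mu_not_subset_inv_S_mu[OF assms that] by (simp add: inv_set_subset_iff)
  then show "F = G" if "F \<in> ?F" "G \<in> ?F" "F \<subseteq> G" for F G
    using that S_mu_not_subset_inv_S_mu[OF assms] eq
    by (elim UnE CollectE exE conjE) (metis inv_mono)+
  show "\<exists>F\<in>?F. N \<subseteq> F"
    if "N \<in> {M. subsemigroup X M \<and> M \<noteq> sym_inv_monoid X}" "Sym X \<subseteq> N" for N
    using proper_subsemigroup_below[OF assms, of N] that by blast
qed

lemma maximal_inverse_subsemigroups_containing_Sym:
  assumes "infinite X"
  shows "{M. maximal_inverse_subsemigroup X M \<and> Sym X \<subseteq> M} =
    {S_mu X \<mu> \<inter> inv_set (S_mu X \<mu>) | \<mu>. admissible X \<mu>}"
  unfolding maximal_inverse_subsemigroup_def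
proof (rule maximal_in_eq_antichain)
  let ?F = "{S_mu X \<mu> \<inter> inv_set (S_mu X \<mu>) | \<mu>. admissible X \<mu>}"
  have "inverse_subsemigroup X (S_mu X \<mu> \<inter> inv_set (S_mu X \<mu>))" if "admissible X \<mu>" for \<mu>
    using S_mu_subsemigroup[OF that] unfolding inverse_subsemigroup_def subsemigroup_def
    by (auto simp: converse_relcomp)
  moreover have "S_mu X \<mu> \<inter> inv_set (S_mu X \<mu>) \<noteq> sym_inv_monoid X" if "admissible X \<mu>" for \<mu>
    using S_mu_proper[OF assms that] S_mu_subsemigroup[OF that]
    unfolding subsemigroup_def by blast
  ultimately show "?F \<subseteq> {M. inverse_subsemigroup X M \<and> M \<noteq> sym_inv_monoid X}"
    by blast
  show "Sym X \<subseteq> F" if "F \<in> ?F" for F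
    using that Sym_subset_S_mu by (auto simp: subset_iff)
  show "F = G" if "F \<in> ?F" "G \<in> ?F" "F \<subseteq> G" for F G
  proof -
    obtain \<mu> \<nu> where \<mu>: "admissible X \<mu>" "F = S_mu X \<mu> \<inter> inv_set (S_mu X \<mu>)"
      and \<nu>: "admissible X \<nu>" "G = S_mu X \<nu> \<inter> inv_set (S_mu X \<nu>)"
      using \<open>F \<in> ?F\<close> \<open>G \<in> ?F\<close> by blast
    have "S_mu X \<mu> = S_mu X \<nu>"
      using \<open>F \<subseteq> G\<close> \<mu>(2) \<nu>(2) by (intro S_mu_Int_inv_subset_S_mu[OF assms \<mu>(1) \<nu>(1)]) simp
    then show ?thesis
      using \<mu>(2) \<nu>(2) by simp
  qed
  show "\<exists>F\<in>?F. N \<subseteq> F"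
    if N: "N \<in> {M. inverse_subsemigroup X M \<and> M \<noteq> sym_inv_monoid X}" "Sym X \<subseteq> N" for N
  proof -
    have sub: "subsemigroup X N" and inv: "N \<subseteq> inv_set N"
      using N(1) unfolding inverse_subsemigroup_def by auto
    obtain \<mu> where \<mu>: "admissible X \<mu>" "N \<subseteq> S_mu X \<mu> \<or> N \<subseteq> inv_set (S_mu X \<mu>)"
      using proper_subsemigroup_below[OF assms sub N(2)] N(1) by blast
    have "inv_set N \<subseteq> N"
      using inv by (simp add: inv_set_subset_iff)
    with \<mu>(2) inv have "N \<subseteq> S_mu X \<mu> \<inter> inv_set (S_mu X \<mu>)"
      using inv_set_subset_iff[of N "S_mu X \<mu>"] by blast
    then show ?thesis
      using \<mu>(1) by blast
  qed
qed

theorem theorem3p1: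
  fixes X :: "'a set"
  assumes "infinite X"
  shows "{M. maximal_subsemigroup X M \<and> Sym X \<subseteq> M} =
           {S_mu X \<mu> | \<mu>. admissible X \<mu>} \<union> {inv_set (S_mu X \<mu>) | \<mu>. admissible X \<mu>}
       \<and> (\<forall>\<mu>. admissible X \<mu> \<longrightarrow>
            inv_set (S_mu X \<mu>) =
              {f \<in> sym_inv_monoid X. collapse X f <o \<mu> \<or> \<mu> \<le>o defect X f})
       \<and> {M. maximal_inverse_subsemigroup X M \<and> Sym X \<subseteq> M} =
           {S_mu X \<mu> \<inter> inv_set (S_mu X \<mu>) | \<mu>. admissible X \<mu>}
       \<and> (\<forall>\<mu>. admissible X \<mu> \<longrightarrow>
            S_mu X \<mu> \<inter> inv_set (S_mu X \<mu>) =
              {f \<in> sym_inv_monoid X. (\<mu> \<le>o collapse X f \<and> \<mu> \<le>o defect X f)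
                 \<or> (collapse X f <o \<mu> \<and> defect X f <o \<mu>)})"
  by (intro conjI allI impI maximal_subsemigroups_containing_Sym[OF assms] inv_S_mu_eq
      maximal_inverse_subsemigroups_containing_Sym[OF assms]
      S_mu_Int_inv_eq[OF admissible_Card_order])

end
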